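(* For every finite simple graph $G$, $\mathrm{sl}(G)=\mathrm{nd}(G)$.
   Context: For a decoder $\mathcal{D}\subseteq\Sigma^2$ and a word $w=w_1\cdots w_n\in\Sigma^*$, the letter graph $G(\mathcal{D},w)$ has vertex set $\{1,\dots,n\}$ and edge set $\{\{i,j\}\mid 1\le i<j\le n,\ w_iw_j\in\mathcal{D}\}$. A decoder is symmetric if $ab\in\mathcal{D}$ iff $ba\in\mathcal{D}$. The symmetric lettericity $\mathrm{sl}(G)$ of $G=(V,E)$ is the smallest size of an alphabet $\Sigma$ such that there are a symmetric decoder $\mathcal{D}\subseteq\Sigma^2$ and a word $w\in\Sigma^{|V|}$ with $G$ isomorphic to $G(\mathcal{D},w)$. Two vertices $u,v$ are generalized twins if $N(u)\setminus\{v\}=N(v)\setminus\{u\}$ ($N$ the open neighborhood). The neighborhood diversity $\mathrm{nd}(G)$ is the smallest number of parts of a partition of $V$ such that any two vertices in the same part are generalized twins. *)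

theory Defs
  imports Main "HOL-Library.Disjoint_Sets"
begin

record 'a ugraph =
  verts :: "'a set"
  edges :: "'a set set"

definition finite_simple_graph :: "'a ugraph \<Rightarrow> bool" where
  "finite_simple_graph G \<longleftrightarrow>
     finite (verts G) \<and> edges G \<subseteq> {{u, v} | u v. u \<in> verts G \<and> v \<in> verts G \<and> u \<noteq> v}"

definition graph_iso :: "'a ugraph \<Rightarrow> 'b ugraph \<Rightarrow> bool" where
  "graph_iso G H \<longleftrightarrow>
     (\<exists>f. bij_betw f (verts G) (verts H) \<and>
          (\<forall>u\<in>verts G. \<forall>v\<in>verts G. {u, v} \<in> edges G \<longleftrightarrow> {f u, f v} \<in> edges H))"

(* Vertices are the positions 1, ..., n of the word; list indexing starts at 0, so that the
   letter at position i is w ! (i - 1). *)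
definition letter_graph :: "('s \<times> 's) set \<Rightarrow> 's list \<Rightarrow> nat ugraph" where
  "letter_graph D w =
     \<lparr> verts = {1..length w},
       edges = {{i, j} | i j. 1 \<le> i \<and> i < j \<and> j \<le> length w \<and> (w ! (i - 1), w ! (j - 1)) \<in> D} \<rparr>"

definition symmetric_decoder :: "'s set \<Rightarrow> ('s \<times> 's) set \<Rightarrow> bool" where
  "symmetric_decoder \<Sigma> D \<longleftrightarrow> D \<subseteq> \<Sigma> \<times> \<Sigma> \<and> (\<forall>a b. (a, b) \<in> D \<longleftrightarrow> (b, a) \<in> D)"

(* Alphabets are finite sets of natural numbers: every finite set is in bijection with one, and
   renaming the letters changes neither the letter graph nor the size of the alphabet. *)
definition symmetric_lettericity :: "'a ugraph \<Rightarrow> nat" where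
  "symmetric_lettericity G =
     (LEAST k. \<exists>(\<Sigma> :: nat set) D w. finite \<Sigma> \<and> card \<Sigma> = k \<and> symmetric_decoder \<Sigma> D \<and>
        set w \<subseteq> \<Sigma> \<and> length w = card (verts G) \<and> graph_iso G (letter_graph D w))"

definition nbh :: "'a ugraph \<Rightarrow> 'a \<Rightarrow> 'a set" where
  "nbh G v = {u \<in> verts G. {u, v} \<in> edges G}"

definition generalized_twins :: "'a ugraph \<Rightarrow> 'a \<Rightarrow> 'a \<Rightarrow> bool" where
  "generalized_twins G u v \<longleftrightarrow> nbh G u - {v} = nbh G v - {u}"

definition neighborhood_diversity :: "'a ugraph \<Rightarrow> nat" where
  "neighborhood_diversity G =
     (LEAST k. \<exists>P. partition_on (verts G) P \<and> finite P \<and> card P = k \<and>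
        (\<forall>B\<in>P. \<forall>u\<in>B. \<forall>v\<in>B. generalized_twins G u v))"

end

theory Submission
  imports Defs
begin

text \<open>
  With a symmetric decoder the order of the letters in the word is irrelevant, so a letter graph
  representation amounts to a labelling of the vertices such that the labels of two distinct
  vertices determine whether they are adjacent. The classes of such a labelling consist of
  generalized twins; conversely, a partition into classes of generalized twins is such a
  labelling.
\<close>

text \<open>Equal vertices are exempt, so a pair \<open>(a, a)\<close> in \<open>D\<close> may make
  all vertices with label \<open>a\<close> pairwise adjacent although no vertex is adjacent to
  itself.\<close>

definition symmetric_labelling :: "'a ugraph \<Rightarrow> ('a \<Rightarrow> 's) \<Rightarrow> ('s \<times> 's) set \<Rightarrow> bool" where
  "symmetric_labelling G c D \<longleftrightarrow> sym D \<and>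
     (\<forall>u\<in>verts G. \<forall>v\<in>verts G. u \<noteq> v \<longrightarrow> ({u, v} \<in> edges G \<longleftrightarrow> (c u, c v) \<in> D))"

lemma finite_simple_graph_no_loop:
  "finite_simple_graph G \<Longrightarrow> {u} \<notin> edges G"
  by (auto simp: finite_simple_graph_def dest!: subsetD)

text \<open>The decoder reads the letter at the smaller position first; symmetry swaps the pair, so
  adjacency can be tested without knowing the order of \<open>i\<close> and
  \<open>j\<close>.\<close>

lemma mem_edges_letter_graph:
  assumes "sym D" "i \<in> {1..length w}" "j \<in> {1..length w}"
  shows "{i, j} \<in> edges (letter_graph D w) \<longleftrightarrow> i \<noteq> j \<and> (w ! (i - 1), w ! (j - 1)) \<in> D"
proof (cases i j rule: linorder_cases)
  case less
  with assms show ?thesis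
    by (auto simp: letter_graph_def doubleton_eq_iff)
next
  case equal
  then show ?thesis
    by (auto simp: letter_graph_def)
next
  case greater
  with assms show ?thesis
    by (auto simp: letter_graph_def doubleton_eq_iff dest: symD)
qed

lemma generalized_twins_same_label:
  assumes "finite_simple_graph G" "symmetric_labelling G c D"
    and "u \<in> verts G" "v \<in> verts G" "c u = c v"
  shows "generalized_twins G u v"
proof -
  \<comment> \<open>Apart from excluding \<open>a\<close> itself, the neighborhood of
    \<open>a\<close> depends on \<open>a\<close> only through its label. For \<open>u\<close> and
    \<open>v\<close> with equal labels the two neighborhoods thus agree once both vertices are
    removed.\<close>
  have "x \<in> nbh G a \<longleftrightarrow> x \<in> verts G \<and> x \<noteq> a \<and> (c x, c a) \<in> D" if "a \<in> verts G" for x a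
    using that assms(2) finite_simple_graph_no_loop[OF assms(1), of a]
    by (cases "x = a") (auto simp: nbh_def symmetric_labelling_def)
  with assms(3-5) show ?thesis
    unfolding generalized_twins_def by (intro set_eqI) auto
qed

lemma symmetric_labelling_letter_graph:
  assumes "graph_iso G (letter_graph D w)" "sym D"
  obtains c where "symmetric_labelling G c D" "c ` verts G \<subseteq> set w"
proof -
  obtain f where f: "bij_betw f (verts G) {1..length w}"
    and E: "\<And>u v. u \<in> verts G \<Longrightarrow> v \<in> verts G \<Longrightarrow>
      {u, v} \<in> edges G \<longleftrightarrow> {f u, f v} \<in> edges (letter_graph D w)"
    using assms(1) by (auto simp: graph_iso_def letter_graph_def)
  have mem: "f u \<in> {1..length w}" if "u \<in> verts G" for u
    using bij_betwE[OF f] that by blast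
  have inj: "f u \<noteq> f v" if "u \<in> verts G" "v \<in> verts G" "u \<noteq> v" for u v
    using f that by (auto simp: bij_betw_def dest: inj_onD)
  show thesis
  proof (rule that)
    \<comment> \<open>The label of a vertex is the letter at its position under the isomorphism,
      shifted because list indices start at 0.\<close>
    show "symmetric_labelling G (\<lambda>u. w ! (f u - 1)) D"
      unfolding symmetric_labelling_def
      using assms(2) E mem inj mem_edges_letter_graph[OF assms(2)] by simp
    show "(\<lambda>u. w ! (f u - 1)) ` verts G \<subseteq> set w"
      using mem by (fastforce intro!: nth_mem)
  qed
qed

lemma twin_partition_of_labelling:
  assumes "finite_simple_graph G" "symmetric_labelling G c D"
  obtains P where "partition_on (verts G) P" "finite P" "card P = card (c ` verts G)"
    "\<forall>B\<in>P. \<forall>u\<in>B. \<forall>v\<in>B. generalized_twins G u v"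
proof -
  define block where "block a = {v \<in> verts G. c v = a}" for a
  \<comment> \<open>Only labels that occur are used, so every block is nonempty; this also makes
    \<open>block\<close> injective on them.\<close>
  define P where "P = block ` c ` verts G"
  have inj: "inj_on block (c ` verts G)"
    by (rule inj_onI) (auto simp: block_def)
  show thesis
  proof (rule that)
    show "partition_on (verts G) P"
      by (rule partition_onI) (auto simp: P_def block_def disjnt_def)
    show "finite P"
      using assms(1) by (simp add: P_def finite_simple_graph_def)
    show "card P = card (c ` verts G)"
      unfolding P_def by (rule card_image[OF inj])
    show "\<forall>B\<in>P. \<forall>u\<in>B. \<forall>v\<in>B. generalized_twins G u v"
      using generalized_twins_same_label[OF assms] by (auto simp: P_def block_def)
  qed
qed

text \<open>The endpoints are replaced one at a time, from \<open>{u', v'}\<close> over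
  \<open>{u, v'}\<close> to \<open>{u, v}\<close>. Twins agree only on vertices outside the pair, so
  \<open>u\<close> must differ from \<open>v'\<close> in the first exchange and from
  \<open>v\<close> in the second.\<close>

lemma edge_transfer_generalized_twins:
  assumes "u \<in> verts G" "u' \<in> verts G" "v' \<in> verts G"
    and "generalized_twins G u' u" "generalized_twins G v' v"
    and "{u', v'} \<in> edges G" "u \<noteq> v" "u \<noteq> v'"
  shows "{u, v} \<in> edges G"
proof -
  have "v' \<in> nbh G u' - {u}"
    using assms by (auto simp: nbh_def insert_commute)
  then have "v' \<in> nbh G u"
    using assms(4) by (auto simp: generalized_twins_def)
  then have "u \<in> nbh G v' - {v}"
    using assms by (auto simp: nbh_def insert_commute)
  then show ?thesis
    using assms(5) by (auto simp: generalized_twins_def nbh_def)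
qed

text \<open>Any numbering of the blocks serves as labelling: since blocks consist of twins, one edge
  between two blocks, or inside one, forces all edges there between distinct vertices.\<close>

lemma labelling_of_twin_partition:
  assumes "partition_on (verts G) P" "finite P"
    and "\<forall>B\<in>P. \<forall>u\<in>B. \<forall>v\<in>B. generalized_twins G u v"
  obtains c :: "'a \<Rightarrow> nat" and D
  where "symmetric_labelling (G :: 'a ugraph) c D" "c ` verts G \<subseteq> {0..<card P}"
    "D \<subseteq> {0..<card P} \<times> {0..<card P}"
proof -
  obtain h where h: "bij_betw h P {0..<card P}"
    using ex_bij_betw_finite_nat[OF assms(2)] by blast
  have "\<exists>B\<in>P. v \<in> B" if "v \<in> verts G" for v
    using that assms(1) by (auto simp: partition_on_def)
  then obtain b where b: "\<And>v. v \<in> verts G \<Longrightarrow> b v \<in> P \<and> v \<in> b v"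
    by metis
  define c where "c v = h (b v)" for v
  \<comment> \<open>The smallest decoder that covers the edges: every edge has its label pair in
    \<open>D\<close> by construction, and only the converse needs the twins.\<close>
  define D where "D = {(c u, c v) | u v. u \<in> verts G \<and> v \<in> verts G \<and> {u, v} \<in> edges G}"
  have cV: "c ` verts G \<subseteq> {0..<card P}"
    using b bij_betwE[OF h] by (force simp: c_def)
  have twins: "generalized_twins G u v"
    if "u \<in> verts G" "v \<in> verts G" "c u = c v" for u v
  proof -
    have "b u = b v"
      using that b h by (auto simp: c_def bij_betw_def dest: inj_onD)
    then show ?thesis
      using that b assms(3) by metis
  qed
  have "{u, v} \<in> edges G" if uv: "u \<in> verts G" "v \<in> verts G" "u \<noteq> v" "(c u, c v) \<in> D" for u v
  proof -
    obtain u' v' where *: "u' \<in> verts G" "v' \<in> verts G" "{u', v'} \<in> edges G"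
      "c u' = c u" "c v' = c v"
      using uv(4) by (auto simp: D_def)
    have tw: "generalized_twins G u' u" "generalized_twins G v' v"
      using twins * uv by auto
    \<comment> \<open>The exchange can pass through \<open>{u, v'}\<close> or through
      \<open>{v, u'}\<close>. If both of these pairs collapse, \<open>{u', v'}\<close> is already
      \<open>{u, v}\<close>.\<close>
    consider "u \<noteq> v'" | "v \<noteq> u'" | "u = v'" "v = u'"
      by blast
    then show ?thesis
    proof cases
      case 1
      then show ?thesis
        using edge_transfer_generalized_twins[of u G u' v' v] uv * tw by blast
    next
      case 2
      then show ?thesis
        using edge_transfer_generalized_twins[of v G v' u' u] uv * tw
        by (simp add: insert_commute)
    next
      case 3
      then show ?thesis
        using *(3) by (simp add: insert_commute)
    qed
  qed
  moreover have "sym D"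
    by (rule symI) (auto simp: D_def; metis insert_commute)
  ultimately have "symmetric_labelling G c D"
    unfolding symmetric_labelling_def by (auto simp: D_def)
  moreover have "D \<subseteq> {0..<card P} \<times> {0..<card P}"
    using cV by (auto simp: D_def)
  ultimately show thesis
    using that cV by blast
qed

text \<open>The word spells the labels along an arbitrary enumeration of the vertices; symmetry of
  \<open>D\<close> makes every order work.\<close>

lemma letter_graph_of_symmetric_labelling:
  assumes "finite_simple_graph G" "symmetric_labelling G c D"
  obtains w where "set w = c ` verts G" "length w = card (verts G)"
    "graph_iso G (letter_graph D w)"
proof -
  define n where "n = card (verts G)"
  have "finite (verts G)"
    using assms(1) by (simp add: finite_simple_graph_def)
  then obtain f where f: "bij_betw f (verts G) {1..n}"
    using ex_bij_betw_nat_finite_1 bij_betw_inv n_def by metis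
  define g where "g = inv_into (verts G) f"
  have g: "bij_betw g {1..n} (verts G)"
    unfolding g_def by (rule bij_betw_inv_into[OF f])
  define w where "w = map (\<lambda>i. c (g i)) [1..<Suc n]"
  have len: "length w = n"
    by (simp add: w_def)
  have letter: "w ! (f u - 1) = c u" and mem: "f u \<in> {1..length w}" if "u \<in> verts G" for u
  proof -
    have fu: "f u \<in> {1..n}"
      using bij_betwE[OF f] that by blast
    then show "f u \<in> {1..length w}"
      by (simp add: len)
    have "g (f u) = u"
      unfolding g_def using bij_betw_inv_into_left[OF f that] .
    then show "w ! (f u - 1) = c u"
      using fu by (auto simp: w_def simp del: upt_Suc)
  qed
  have inj: "f u \<noteq> f v" if "u \<in> verts G" "v \<in> verts G" "u \<noteq> v" for u v
    using f that by (auto simp: bij_betw_def dest: inj_onD)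
  have "sym D"
    using assms(2) by (simp add: symmetric_labelling_def)
  \<comment> \<open>For \<open>u = v\<close> both sides are false: \<open>G\<close> has no loops,
    and an edge of a letter graph joins distinct positions.\<close>
  have edge: "{u, v} \<in> edges G \<longleftrightarrow> {f u, f v} \<in> edges (letter_graph D w)"
    if "u \<in> verts G" "v \<in> verts G" for u v
    unfolding mem_edges_letter_graph[OF \<open>sym D\<close> mem[OF that(1)] mem[OF that(2)]]
    using that inj letter assms(2) finite_simple_graph_no_loop[OF assms(1), of u]
    by (cases "u = v") (auto simp: symmetric_labelling_def)
  show thesis
  proof (rule that)
    have "set w = c ` g ` {1..n}"
      by (auto simp: w_def simp del: upt_Suc)
    then show "set w = c ` verts G"
      using g by (simp add: bij_betw_def)
    show "length w = card (verts G)"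
      by (simp add: len n_def)
    show "graph_iso G (letter_graph D w)"
      unfolding graph_iso_def using f edge len
      by (intro exI[of _ f]) (simp add: letter_graph_def)
  qed
qed

theorem theorem4:
  fixes G :: "'a ugraph"
  assumes "finite_simple_graph G"
  shows "symmetric_lettericity G = neighborhood_diversity G"
proof -
  let ?S = "\<lambda>k. \<exists>(\<Sigma> :: nat set) D w. finite \<Sigma> \<and> card \<Sigma> = k \<and> symmetric_decoder \<Sigma> D \<and>
        set w \<subseteq> \<Sigma> \<and> length w = card (verts G) \<and> graph_iso G (letter_graph D w)"
  let ?N = "\<lambda>k. \<exists>P. partition_on (verts G) P \<and> finite P \<and> card P = k \<and>
        (\<forall>B\<in>P. \<forall>u\<in>B. \<forall>v\<in>B. generalized_twins G u v)"
  \<comment> \<open>The block numbers form the alphabet, so its size is exactly the number of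
    blocks.\<close>
  have S_of_N: "?S k" if "?N k" for k
  proof -
    from that obtain P where P: "partition_on (verts G) P" "finite P" "card P = k"
        "\<forall>B\<in>P. \<forall>u\<in>B. \<forall>v\<in>B. generalized_twins G u v"
      by blast
    obtain c :: "'a \<Rightarrow> nat" and D where c: "symmetric_labelling G c D"
        "c ` verts G \<subseteq> {0..<card P}" "D \<subseteq> {0..<card P} \<times> {0..<card P}"
      using labelling_of_twin_partition[OF P(1,2,4)] .
    obtain w where w: "set w = c ` verts G" "length w = card (verts G)"
        "graph_iso G (letter_graph D w)"
      using letter_graph_of_symmetric_labelling[OF assms c(1)] .
    have "symmetric_decoder {0..<card P} D"
      using c by (auto simp: symmetric_decoder_def symmetric_labelling_def dest: symD)
    then show ?thesis
      using w c P(3) by (intro exI[of _ "{0..<card P}"] exI[of _ D] exI[of _ w]) auto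
  qed
  \<comment> \<open>The labels used may be fewer than the letters of \<Sigma>, so the partition
    obtained may have fewer than \<open>k\<close> blocks; to compare the minima this bound
    suffices.\<close>
  have N_of_S: "\<exists>m\<le>k. ?N m" if S: "?S k" for k
  proof -
    from S obtain \<Sigma> :: "nat set" and D w where w: "finite \<Sigma>" "card \<Sigma> = k"
        "symmetric_decoder \<Sigma> D" "set w \<subseteq> \<Sigma>" "graph_iso G (letter_graph D w)"
      by blast
    have "sym D"
      using w(3) by (auto simp: symmetric_decoder_def intro: symI)
    obtain c where c: "symmetric_labelling G c D" "c ` verts G \<subseteq> set w"
      using symmetric_labelling_letter_graph[OF w(5) \<open>sym D\<close>] .
    obtain P where P: "partition_on (verts G) P" "finite P" "card P = card (c ` verts G)"
        "\<forall>B\<in>P. \<forall>u\<in>B. \<forall>v\<in>B. generalized_twins G u v"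
      using twin_partition_of_labelling[OF assms c(1)] .
    have "card P \<le> k"
      using P(3) c(2) w(1,2,4) by (metis card_mono subset_trans)
    then show ?thesis
      using P by blast
  qed
  \<comment> \<open>Labelling each vertex by itself, with adjacency as decoder, yields the partition
    into singletons. Hence some \<open>k\<close> satisfies \<open>?N\<close>, thus also
    \<open>?S\<close>, and both minima are attained.\<close>
  have "symmetric_labelling G id {(u, v). {u, v} \<in> edges G}"
    by (auto simp: symmetric_labelling_def insert_commute intro: symI)
  from twin_partition_of_labelling[OF assms this] have N: "\<exists>k. ?N k"
    by metis
  have N_least: "?N (LEAST k. ?N k)"
    using N by (rule LeastI_ex)
  have S_least: "?S (LEAST k. ?S k)"
    using S_of_N[OF N_least] by (rule LeastI)
  obtain m where m: "m \<le> (LEAST k. ?S k)" "?N m"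
    using N_of_S[OF S_least] by blast
  show ?thesis
    unfolding symmetric_lettericity_def neighborhood_diversity_def
  proof (rule antisym)
    show "(LEAST k. ?S k) \<le> (LEAST k. ?N k)"
      using S_of_N[OF N_least] by (rule Least_le)
    have "(LEAST k. ?N k) \<le> m"
      using m(2) by (rule Least_le)
    with m(1) show "(LEAST k. ?N k) \<le> (LEAST k. ?S k)"
      by (rule order_trans[rotated])
  qed
qed

end
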